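(* Let $n$ be an odd positive integer, let $\mathbb{Z}_n\rtimes\mathbb{Z}_2$ be a semidirect product (with respect to some action of $\mathbb{Z}_2$ on $\mathbb{Z}_n$ by automorphisms), and let $G$ be a group of order $2n$ such that the pair $(G,\,\mathbb{Z}_n\rtimes\mathbb{Z}_2)$ is realizable. Then there exist positive integers $k,l$ with $\gcd(k,l)=1$ and $kl=n$ such that $G\cong(\mathbb{Z}_k\rtimes\mathbb{Z}_l)\rtimes\mathbb{Z}_2$ for some semidirect products of the indicated form.
   Context: $\mathbb{Z}_m$ denotes the cyclic group of order $m$. For a group $N$, the holomorph is $\mathrm{Hol}(N)=N\rtimes\mathrm{Aut}(N)$, regarded as a group of permutations of $N$ via $(x,\alpha)\cdot y=x\,\alpha(y)$. A subgroup of $\mathrm{Hol}(N)$ is regular if it acts on $N$ transitively with trivial point stabilizers. For finite groups $G,N$ with $|G|=|N|$, the (ordered) pair $(G,N)$ is called realizable (Hopf-Galois realizable) if $\mathrm{Hol}(N)$ has a regular subgroup isomorphic to $G$. In $A\rtimes B$ the factor $A$ is the normal one. *)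

theory Defs
  imports "HOL-Algebra.Algebra"
begin

text \<open>
  The external semidirect product of \<open>A\<close> (the normal factor) and \<open>B\<close>. It is a group when
  \<open>\<phi> \<in> hom B (AutoGroup A)\<close>.
\<close>
definition semidirect_prod ::
    "('a, 'm) monoid_scheme \<Rightarrow> ('b \<Rightarrow> 'a \<Rightarrow> 'a) \<Rightarrow> ('b, 'n) monoid_scheme \<Rightarrow> ('a \<times> 'b) monoid"
    (\<open>(_ \<rtimes>\<^bsub>_\<^esub> _)\<close> [71, 0, 71] 70) where
  "A \<rtimes>\<^bsub>\<phi>\<^esub> B =
     \<lparr>carrier = carrier A \<times> carrier B,
      monoid.mult = (\<lambda>(a, b) (a', b'). (a \<otimes>\<^bsub>A\<^esub> \<phi> b a', b \<otimes>\<^bsub>B\<^esub> b')),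
      one = (\<one>\<^bsub>A\<^esub>, \<one>\<^bsub>B\<^esub>)\<rparr>"

definition Hol :: "('a, 'm) monoid_scheme \<Rightarrow> ('a \<times> ('a \<Rightarrow> 'a)) monoid" where
  "Hol N = N \<rtimes>\<^bsub>(\<lambda>\<alpha>. \<alpha>)\<^esub> AutoGroup N"

text \<open>Restricted to the carrier because elements of \<^const>\<open>Bij\<close> are extensional functions.\<close>
definition Hol_act :: "('a, 'm) monoid_scheme \<Rightarrow> 'a \<times> ('a \<Rightarrow> 'a) \<Rightarrow> 'a \<Rightarrow> 'a" where
  "Hol_act N = (\<lambda>(x, \<alpha>). \<lambda>y \<in> carrier N. x \<otimes>\<^bsub>N\<^esub> \<alpha> y)"

definition regular_subgroup ::
    "('a \<times> ('a \<Rightarrow> 'a)) set \<Rightarrow> ('a, 'm) monoid_scheme \<Rightarrow> bool" where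
  "regular_subgroup H N \<longleftrightarrow>
     subgroup H (Hol N) \<and>
     transitive_action (Hol N\<lparr>carrier := H\<rparr>) (carrier N) (Hol_act N) \<and>
     (\<forall>y \<in> carrier N. stabilizer (Hol N\<lparr>carrier := H\<rparr>) (Hol_act N) y = {\<one>\<^bsub>Hol N\<^esub>})"

text \<open>Meant for finite groups \<open>G\<close> and \<open>N\<close> of the same order.\<close>
definition realizable :: "('g, 'k) monoid_scheme \<Rightarrow> ('a, 'm) monoid_scheme \<Rightarrow> bool" where
  "realizable G N \<longleftrightarrow> (\<exists>H. regular_subgroup H N \<and> G \<cong> Hol N\<lparr>carrier := H\<rparr>)"

lemma semidirect_prod_simps [simp]:
  "carrier (A \<rtimes>\<^bsub>\<phi>\<^esub> B) = carrier A \<times> carrier B"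
  "(a, b) \<otimes>\<^bsub>A \<rtimes>\<^bsub>\<phi>\<^esub> B\<^esub> (a', b') = (a \<otimes>\<^bsub>A\<^esub> \<phi> b a', b \<otimes>\<^bsub>B\<^esub> b')"
  "\<one>\<^bsub>A \<rtimes>\<^bsub>\<phi>\<^esub> B\<^esub> = (\<one>\<^bsub>A\<^esub>, \<one>\<^bsub>B\<^esub>)"
  by (simp_all add: semidirect_prod_def)

lemma AutoGroup_simps:
  "carrier (AutoGroup N) = auto N"
  "\<one>\<^bsub>AutoGroup N\<^esub> = (\<lambda>x \<in> carrier N. x)"
  "\<lbrakk>f \<in> auto N; g \<in> auto N\<rbrakk> \<Longrightarrow> f \<otimes>\<^bsub>AutoGroup N\<^esub> g = compose (carrier N) f g"
  by (auto simp: AutoGroup_def BijGroup_def auto_def)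

lemma auto_closed: "\<lbrakk>f \<in> auto N; x \<in> carrier N\<rbrakk> \<Longrightarrow> f x \<in> carrier N"
  and auto_mult:
    "\<lbrakk>f \<in> auto N; x \<in> carrier N; y \<in> carrier N\<rbrakk> \<Longrightarrow> f (x \<otimes>\<^bsub>N\<^esub> y) = f x \<otimes>\<^bsub>N\<^esub> f y"
  and auto_bij: "f \<in> auto N \<Longrightarrow> bij_betw f (carrier N) (carrier N)"
  and auto_ext: "f \<in> auto N \<Longrightarrow> f \<in> extensional (carrier N)"
  by (auto simp: auto_def Bij_def hom_def)

lemma auto_one: "group N \<Longrightarrow> f \<in> auto N \<Longrightarrow> f \<one>\<^bsub>N\<^esub> = \<one>\<^bsub>N\<^esub>"
  by (rule hom_one) (auto simp: auto_def)

lemma group_semidirect_prod: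
  assumes "group A" "group B" and \<phi>: "\<phi> \<in> hom B (AutoGroup A)"
  shows "group (A \<rtimes>\<^bsub>\<phi>\<^esub> B)"
proof -
  interpret A: group A by fact
  interpret B: group B by fact
  interpret \<phi>: group_hom B "AutoGroup A" \<phi>
    using assms A.AutoGroup by (simp add: group_hom_def group_hom_axioms_def)
  have au: "\<phi> b \<in> auto A" if "b \<in> carrier B" for b
    using \<phi>.hom_closed[OF that] by (simp add: AutoGroup_simps)
  have cl: "\<phi> b a \<in> carrier A" if "b \<in> carrier B" "a \<in> carrier A" for a b
    using au that by (blast intro: auto_closed)
  have mul: "\<phi> (b \<otimes>\<^bsub>B\<^esub> b') a = \<phi> b (\<phi> b' a)"
    if "b \<in> carrier B" "b' \<in> carrier B" "a \<in> carrier A" for a b b'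
    using that au by (simp add: AutoGroup_simps compose_eq)
  have one: "\<phi> \<one>\<^bsub>B\<^esub> a = a" if "a \<in> carrier A" for a
    using that by (simp add: AutoGroup_simps)
  show ?thesis
  proof (rule groupI)
    fix p assume "p \<in> carrier (A \<rtimes>\<^bsub>\<phi>\<^esub> B)"
    then obtain a b where p: "p = (a, b)" and a: "a \<in> carrier A" and b: "b \<in> carrier B" by auto
    let ?q = "(\<phi> (inv\<^bsub>B\<^esub> b) (inv\<^bsub>A\<^esub> a), inv\<^bsub>B\<^esub> b)"
    have "\<phi> (inv\<^bsub>B\<^esub> b) (inv\<^bsub>A\<^esub> a) \<otimes>\<^bsub>A\<^esub> \<phi> (inv\<^bsub>B\<^esub> b) a = \<one>\<^bsub>A\<^esub>"
      using a b auto_mult[OF au[OF B.inv_closed[OF b]] A.inv_closed[OF a] a]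
        auto_one[OF assms(1) au[OF B.inv_closed[OF b]]]
      by (simp del: \<phi>.hom_inv)
    with a b p cl show "\<exists>q\<in>carrier (A \<rtimes>\<^bsub>\<phi>\<^esub> B). q \<otimes>\<^bsub>A \<rtimes>\<^bsub>\<phi>\<^esub> B\<^esub> p = \<one>\<^bsub>A \<rtimes>\<^bsub>\<phi>\<^esub> B\<^esub>"
      by (intro bexI[of _ ?q]) (simp_all del: \<phi>.hom_inv)
  qed (auto simp: cl mul one A.m_assoc B.m_assoc auto_mult[OF au] simp del: \<phi>.hom_mult \<phi>.hom_one)
qed

lemma group_Hol: "group N \<Longrightarrow> group (Hol N)"
  unfolding Hol_def
  by (rule group_semidirect_prod) (auto simp: group.AutoGroup hom_def)

lemma faithful_Hol_act:
  assumes "group N"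
  shows "faithful_action (Hol N) (carrier N) (Hol_act N)"
proof -
  interpret N: group N by fact
  have B: "Hol_act N (x, f) \<in> Bij (carrier N)" if x: "x \<in> carrier N" and f: "f \<in> auto N" for x f
  proof -
    have "bij_betw (\<lambda>y. x \<otimes>\<^bsub>N\<^esub> y) (carrier N) (carrier N)"
      by (rule bij_betw_byWitness[where f' = "\<lambda>y. inv\<^bsub>N\<^esub> x \<otimes>\<^bsub>N\<^esub> y"])
         (auto simp: x N.m_assoc[symmetric])
    from bij_betw_trans[OF auto_bij[OF f] this]
    have "bij_betw (Hol_act N (x, f)) (carrier N) (carrier N)"
      by (rule bij_betw_cong[THEN iffD1, rotated]) (simp add: Hol_act_def)
    thus ?thesis by (simp add: Bij_def Hol_act_def)
  qed
  have "Hol_act N \<in> hom (Hol N) (BijGroup (carrier N))"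
  proof (rule homI)
    fix p q assume "p \<in> carrier (Hol N)" "q \<in> carrier (Hol N)"
    then obtain x f y g where pq: "p = (x, f)" "q = (y, g)"
      and m: "x \<in> carrier N" "y \<in> carrier N" "f \<in> auto N" "g \<in> auto N"
      by (auto simp: Hol_def AutoGroup_simps)
    have "Hol_act N (p \<otimes>\<^bsub>Hol N\<^esub> q) = compose (carrier N) (Hol_act N p) (Hol_act N q)"
      using m by (auto simp: pq Hol_def Hol_act_def AutoGroup_simps compose_def fun_eq_iff
                    auto_closed auto_mult N.m_assoc)
    thus "Hol_act N (p \<otimes>\<^bsub>Hol N\<^esub> q) = Hol_act N p \<otimes>\<^bsub>BijGroup (carrier N)\<^esub> Hol_act N q"
      using m B by (simp add: BijGroup_def pq)
  qed (auto simp: Hol_def AutoGroup_simps BijGroup_def B)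
  moreover have "inj_on (Hol_act N) (carrier (Hol N))"
  proof (rule inj_onI)
    fix p q assume "p \<in> carrier (Hol N)" "q \<in> carrier (Hol N)" and eq: "Hol_act N p = Hol_act N q"
    then obtain x f y g where pq: "p = (x, f)" "q = (y, g)"
      and m: "x \<in> carrier N" "y \<in> carrier N" "f \<in> auto N" "g \<in> auto N"
      by (auto simp: Hol_def AutoGroup_simps)
    have E: "x \<otimes>\<^bsub>N\<^esub> f z = y \<otimes>\<^bsub>N\<^esub> g z" if "z \<in> carrier N" for z
      using fun_cong[OF eq, of z] that by (simp add: pq Hol_act_def)
    have xy: "x = y" using E[of "\<one>\<^bsub>N\<^esub>"] m by (simp add: auto_one[OF assms])
    have "f = g"
    proof (rule extensionalityI[OF auto_ext auto_ext])
      fix z assume "z \<in> carrier N"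
      thus "f z = g z" using E[of z] m xy by (simp add: auto_closed)
    qed (use m in auto)
    with xy show "p = q" by (simp add: pq)
  qed
  ultimately show ?thesis
    using group_Hol[OF assms] group_BijGroup
    by (simp add: faithful_action_def faithful_action_axioms_def group_action_def
          group_hom_def group_hom_axioms_def)
qed

end

theory Submission
  imports Defs "HOL-Number_Theory.Cong"
begin

text \<open>
  Let \<open>N\<close> be the semidirect product of a cyclic group \<open>C\<close> of odd order \<open>n\<close> by a group of order two, and
  let \<open>R\<close> be a regular subgroup of the holomorph of \<open>N\<close>. As \<open>C\<close> is the set of elements of \<open>N\<close> whose
  \<open>n\<close>-th power is trivial, it is invariant under automorphisms, and the holomorph permutes its two cosets
  (\<open>parity_hom\<close>). The elements of \<open>R\<close> that map \<open>C\<close> to itself form a normal subgroup \<open>H\<close> of index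
  two. By regularity of \<open>R\<close>, the group \<open>H\<close> acts regularly on \<open>C\<close>, by affine maps
  \<open>y \<mapsto> x + v * y\<close> (\<open>regular_affine_group_even_part\<close>). A power with exponent \<open>n\<close> of an element
  outside \<open>H\<close> is an involution that complements \<open>H\<close> (\<open>iso_semidirect_prod_two\<close>). It remains to
  decompose \<open>H\<close>.

  The decomposition (\<open>iso_semidirect_cyclic\<close>) is read off from the element \<open>g\<close> of \<open>H\<close> that maps \<open>0\<close>
  to \<open>1\<close>, say \<open>g y = 1 + u * y\<close>. Let \<open>l\<close> be the part of \<open>n\<close> supported on the primes that divide
  \<open>u - 1\<close>, and \<open>k = n / l\<close>. Modulo \<open>l\<close>, the map \<open>g\<close> is a single cycle, by the
  lifting-the-exponent lemma (\<open>dvd_geometric_sum_iff\<close>). Modulo \<open>k\<close> it has a fixed point, because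
  \<open>u - 1\<close> is invertible. Hence \<open>g ^ l\<close> has a fixed point modulo \<open>n\<close>, and freeness forces
  \<open>g ^ l = \<one>\<close>. On the other hand, commutators in \<open>H\<close> are pure translations, and those of \<open>g\<close> already
  show that \<open>H\<close> contains the translation by \<open>l\<close> (\<open>coprime_part_translation\<close>). That translation
  generates a normal cyclic subgroup of order \<open>k\<close>, and \<open>g\<close> generates a complement of order \<open>l\<close>.
\<close>

(* From here on, primes are those of factorial semirings, not those of divisibility monoids. *)
hide_const (open) Divisibility.prime

section \<open>Divisibility of geometric sums\<close>

lemma geometric_sum_add:
  fixes u :: "'a :: comm_semiring_1"
  shows "(\<Sum>i<a + b. u ^ i) = (\<Sum>i<a. u ^ i) + u ^ a * (\<Sum>i<b. u ^ i)"
  by (induction b) (simp_all add: algebra_simps power_add)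

lemma geometric_sum_mult:
  fixes u :: "'a :: comm_semiring_1"
  shows "(\<Sum>i<a * b. u ^ i) = (\<Sum>i<a. u ^ i) * (\<Sum>i<b. (u ^ a) ^ i)"
proof (induction b)
  case (Suc b)
  have "(\<Sum>i<a * Suc b. u ^ i) = (\<Sum>i<a * b + a. u ^ i)" by (simp add: add.commute)
  also have "\<dots> = (\<Sum>i<a * b. u ^ i) + u ^ (a * b) * (\<Sum>i<a. u ^ i)"
    by (rule geometric_sum_add)
  finally show ?case using Suc by (simp add: algebra_simps power_mult)
qed simp

text \<open>
  For \<open>u \<noteq> 1\<close> this is the lifting-the-exponent lemma for \<open>(u ^ j - 1) / (u - 1)\<close>. Modulo \<open>p\<close> the sum is
  \<open>j\<close>, so \<open>p\<close> divides both or neither. If \<open>j = p * m\<close>, the sum factors into the sum of length \<open>p\<close> for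
  \<open>u\<close> and the sum of length \<open>m\<close> for \<open>u ^ p\<close>; the first factor is \<open>p\<close> modulo \<open>p\<^sup>2\<close>, so it
  contributes exactly one factor \<open>p\<close>. The prime \<open>2\<close> has to be excluded: \<open>1 + 3 = 4\<close>.
\<close>
lemma prime_power_dvd_geometric_sum_iff:
  fixes u :: int
  assumes p: "prime p" "odd p" and "int p dvd u - 1"
  shows "int p ^ e dvd (\<Sum>i<j. u ^ i) \<longleftrightarrow> p ^ e dvd j"
  using assms(3)
proof (induction e arbitrary: u j)
  case (Suc e)
  have "[u = 1] (mod int p)" using Suc.prems by (simp add: cong_iff_dvd_diff)
  then have "[(\<Sum>i<j. u ^ i) = (\<Sum>i<j. 1 ^ i)] (mod int p)" by (intro cong_sum cong_pow)
  then have p_dvd: "int p dvd (\<Sum>i<j. u ^ i) \<longleftrightarrow> p dvd j"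
    by (simp add: cong_dvd_iff)
  show ?case
  proof (cases "p dvd j")
    case False
    with p_dvd show ?thesis by (meson dvd_power_le dvd_refl dvd_trans le_add1 plus_1_eq_Suc dvd_power zero_less_Suc)
  next
    case True
    then obtain m where j: "j = p * m" by blast
    obtain t where t: "u = 1 + int p * t" using Suc.prems by (metis add.commute diff_add_cancel dvdE)
    \<comment> \<open>the binomial expansion of \<open>(1 + p * t) ^ i\<close> to first order\<close>
    have "[u ^ i = 1 + int i * (int p * t)] (mod (int p)\<^sup>2)" for i
    proof (induction i)
      case (Suc i)
      have "[u * u ^ i = u * (1 + int i * (int p * t))] (mod (int p)\<^sup>2)"
        using Suc by (rule cong_scalar_left)
      also have "u * (1 + int i * (int p * t)) = 1 + int (Suc i) * (int p * t) + (int p)\<^sup>2 * (int i * t\<^sup>2)"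
        by (simp add: t algebra_simps power2_eq_square)
      also have "[\<dots> = 1 + int (Suc i) * (int p * t)] (mod (int p)\<^sup>2)"
        by (simp add: cong_iff_dvd_diff)
      finally show ?case by simp
    qed simp
    then have "[(\<Sum>i<p. u ^ i) = (\<Sum>i<p. 1 + int i * (int p * t))] (mod (int p)\<^sup>2)"
      by (intro cong_sum) auto
    also have "(\<Sum>i<p. 1 + int i * (int p * t)) = int p + int p * t * int (\<Sum>i<p. i)"
      by (simp add: sum.distrib sum_distrib_left algebra_simps)
    also have "[\<dots> = int p] (mod (int p)\<^sup>2)"
    proof -
      \<comment> \<open>\<open>p\<close> divides the triangular number \<open>p * (p - 1) / 2\<close> because \<open>p\<close> is odd\<close>
      have "2 * (\<Sum>i<m. i) = m * (m - 1)" for m :: nat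
        by (induction m) (auto simp: algebra_simps)
      then have "p dvd 2 * (\<Sum>i<p. i)" by simp
      moreover have "coprime p 2" using p by simp
      ultimately have "p dvd (\<Sum>i<p. i)" by (simp add: coprime_dvd_mult_right_iff)
      then have "int p dvd int (\<Sum>i<p. i)" by presburger
      then have "int p * int p dvd int p * t * int (\<Sum>i<p. i)" by (simp add: mult_dvd_mono)
      then show ?thesis by (simp add: cong_iff_dvd_diff power2_eq_square)
    qed
    finally have "(int p)\<^sup>2 dvd (\<Sum>i<p. u ^ i) - int p" by (simp add: cong_iff_dvd_diff)
    then obtain c where "(\<Sum>i<p. u ^ i) - int p = (int p)\<^sup>2 * c" by blast
    then have c: "(\<Sum>i<p. u ^ i) = int p * (1 + int p * c)"
      by (simp add: algebra_simps power2_eq_square)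
    have cop: "coprime (int p ^ e) (1 + int p * c)"
      by (intro coprime_power_left_iff[THEN iffD2] disjI1) (metis coprime_commute coprime_1_left coprime_iff_gcd_eq_1 gcd_add_mult mult.commute add.commute)
    have up: "int p dvd u ^ p - 1"
      using \<open>[u = 1] (mod int p)\<close> by (metis cong_iff_dvd_diff cong_pow power_one)
    have "int p ^ Suc e dvd (\<Sum>i<j. u ^ i) \<longleftrightarrow> int p ^ e dvd (1 + int p * c) * (\<Sum>i<m. (u ^ p) ^ i)"
      using p by (simp add: j geometric_sum_mult c mult.assoc prime_gt_0_nat)
    also have "\<dots> \<longleftrightarrow> int p ^ e dvd (\<Sum>i<m. (u ^ p) ^ i)"
      using cop by (simp add: coprime_dvd_mult_right_iff)
    also have "\<dots> \<longleftrightarrow> p ^ e dvd m" by (rule Suc.IH[OF up])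
    also have "\<dots> \<longleftrightarrow> p ^ Suc e dvd j" using p by (simp add: j prime_gt_0_nat)
    finally show ?thesis .
  qed
qed simp

lemma dvd_iff_prime_powers_dvd:
  fixes l m :: nat
  assumes "l > 0"
  shows "l dvd m \<longleftrightarrow> (\<forall>p e. prime p \<longrightarrow> p ^ e dvd l \<longrightarrow> p ^ e dvd m)"
proof (cases "m = 0")
  case False
  show ?thesis
  proof
    assume *: "\<forall>p e. prime p \<longrightarrow> p ^ e dvd l \<longrightarrow> p ^ e dvd m"
    show "l dvd m"
    proof (rule multiplicity_le_imp_dvd)
      fix p :: nat assume "prime p"
      with * False show "multiplicity p l \<le> multiplicity p m"
        by (intro multiplicity_geI) (auto simp: multiplicity_dvd)
    qed (use assms in simp)
  qed (blast intro: dvd_trans)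
qed simp

text \<open>
  This computes the order of the affine map \<open>y \<mapsto> 1 + u * y\<close> on the integers modulo \<open>l\<close>: its
  \<open>j\<close>-th power sends \<open>0\<close> to the sum below, so \<open>0\<close> has an orbit of full length \<open>l\<close>.
\<close>
lemma dvd_geometric_sum_iff:
  fixes u :: int
  assumes "odd l" and primes: "\<And>p. prime p \<Longrightarrow> p dvd l \<Longrightarrow> int p dvd u - 1"
  shows "int l dvd (\<Sum>i<j. u ^ i) \<longleftrightarrow> l dvd j"
proof -
  have l: "l > 0" using \<open>odd l\<close> by (auto intro: Nat.gr0I)
  have "int l dvd (\<Sum>i<j. u ^ i) \<longleftrightarrow> l dvd nat \<bar>\<Sum>i<j. u ^ i\<bar>" by simp
  also have "\<dots> \<longleftrightarrow> (\<forall>p e. prime p \<longrightarrow> p ^ e dvd l \<longrightarrow> p ^ e dvd nat \<bar>\<Sum>i<j. u ^ i\<bar>)"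
    by (rule dvd_iff_prime_powers_dvd[OF l])
  also have "\<dots> \<longleftrightarrow> (\<forall>p e. prime p \<longrightarrow> p ^ e dvd l \<longrightarrow> p ^ e dvd j)"
  proof -
    have "p ^ e dvd nat \<bar>\<Sum>i<j. u ^ i\<bar> \<longleftrightarrow> p ^ e dvd j" if p: "prime p" and e: "p ^ e dvd l" for p e
    proof (cases "e = 0")
      case False
      then have "p dvd l" using e by (meson dvd_power dvd_trans neq0_conv)
      then have "odd p" using \<open>odd l\<close> by (blast intro: dvd_trans)
      have "p ^ e dvd nat \<bar>\<Sum>i<j. u ^ i\<bar> \<longleftrightarrow> int p ^ e dvd (\<Sum>i<j. u ^ i)"
        by (metis int_dvd_int_iff nat_abs_dvd_iff of_nat_power dvd_nat_abs_iff)
      with prime_power_dvd_geometric_sum_iff[OF p \<open>odd p\<close> primes[OF p \<open>p dvd l\<close>]]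
      show ?thesis by simp
    qed simp
    then show ?thesis by blast
  qed
  also have "\<dots> \<longleftrightarrow> l dvd j" by (rule dvd_iff_prime_powers_dvd[OF l, symmetric])
  finally show ?thesis .
qed

text \<open>
  The primes of \<open>n\<close> are sorted according to whether they divide \<open>c\<close>. For each prime the full power
  goes to one side, hence the two factors are coprime.
\<close>
lemma split_off_coprime_part:
  fixes n :: nat and c :: int
  assumes "n > 0"
  obtains k l where "n = k * l" "coprime (int k) c" "\<And>p. prime p \<Longrightarrow> p dvd l \<Longrightarrow> int p dvd c"
proof -
  have "\<exists>k l. n = k * l \<and> coprime (int k) c \<and> (\<forall>p. prime p \<longrightarrow> p dvd l \<longrightarrow> int p dvd c)"
    using assms
  proof (induction n rule: less_induct)
    case (less n)
    show ?case
    proof (cases "coprime (int n) c")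
      case True
      then show ?thesis by (intro exI[of _ n] exI[of _ 1]) auto
    next
      case False
      then have "gcd n (nat \<bar>c\<bar>) \<noteq> 1" 
        by (metis coprime_iff_gcd_eq_1 gcd_int_int_eq gcd_abs2_int int_nat_eq abs_ge_zero of_nat_1)
      then obtain p where p: "prime p" "p dvd gcd n (nat \<bar>c\<bar>)" by (meson prime_factor_nat)
      then have "p dvd n" by (meson dvd_trans gcd_dvd1)
      then obtain m where m: "n = p * m" by blast
      with less.prems p have "m < n" "m > 0" using prime_gt_1_nat[OF p(1)] by auto
      from less.IH[OF this] obtain k l where kl: "m = k * l" "coprime (int k) c"
        "\<forall>q. prime q \<longrightarrow> q dvd l \<longrightarrow> int q dvd c" by blast
      have "p dvd nat \<bar>c\<bar>" using p by (meson dvd_trans gcd_dvd2)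
      then have "int p dvd c" by (simp flip: int_dvd_int_iff)
      with kl p have "\<forall>q. prime q \<longrightarrow> q dvd p * l \<longrightarrow> int q dvd c"
        by (metis prime_dvd_mult_nat primes_dvd_imp_eq)
      with kl m show ?thesis by (intro exI[of _ k] exI[of _ "p * l"]) auto
    qed
  qed
  with that show thesis by blast
qed

section \<open>Internal semidirect products\<close>

lemma (in group) int_pow_mon_integer_mod_group:
  assumes a: "a \<in> carrier G" and "ord a = k" "k > 0"
  shows "(\<lambda>c::int. a [^] c) \<in> mon (integer_mod_group k) G"
proof -
  have "a [^] ((x + y) mod int k) = a [^] x \<otimes> a [^] y" for x y :: int
  proof -
    have "a [^] ((x + y) mod int k) = a [^] (x + y)"
      using a assms(2) by (simp add: int_pow_eq mod_eq_dvd_iff[symmetric])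
    then show ?thesis using a by (simp add: int_pow_mult)
  qed
  moreover have "inj_on (\<lambda>c::int. a [^] c) (carrier (integer_mod_group k))"
  proof (rule inj_onI)
    fix x y assume "x \<in> carrier (integer_mod_group k)" "y \<in> carrier (integer_mod_group k)"
      and "a [^] x = a [^] y"
    then have "y mod int k = x mod int k"
      using a assms by (simp add: int_pow_eq mod_eq_dvd_iff)
    with \<open>x \<in> _\<close> \<open>y \<in> _\<close> \<open>k > 0\<close> show "x = y" by (simp add: carrier_integer_mod_group)
  qed
  ultimately show ?thesis using a by (auto simp: mon_def hom_def)
qed

text \<open>
  Recognizes a semidirect product from embeddings of its factors; \<open>B\<close> acts on \<open>A\<close> by conjugation
  inside \<open>G\<close>. The condition on the orders takes the place of \<open>f(A) h(B) = G\<close>: the map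
  \<open>(a, b) \<mapsto> f a \<otimes> h b\<close> is injective, and counting makes it surjective.
\<close>
lemma (in group) iso_semidirect_prod:
  fixes A :: "('c, 'm) monoid_scheme" and B :: "('d, 'n) monoid_scheme"
  assumes "group A" "group B" "f \<in> mon A G" "h \<in> mon B G"
    and normalizes: "\<And>a b. a \<in> carrier A \<Longrightarrow> b \<in> carrier B \<Longrightarrow> h b \<otimes> f a \<otimes> inv (h b) \<in> f ` carrier A"
    and meet: "\<And>b. b \<in> carrier B \<Longrightarrow> h b \<in> f ` carrier A \<Longrightarrow> h b = \<one>"
    and orders: "order A * order B = order G" and fin: "finite (carrier G)"
  shows "\<exists>\<phi> \<in> hom B (AutoGroup A). G \<cong> A \<rtimes>\<^bsub>\<phi>\<^esub> B"
proof -
  interpret A: group A by fact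
  interpret B: group B by fact
  interpret f: group_hom A G f
    using \<open>f \<in> mon A G\<close> by unfold_locales (simp add: mon_def)
  interpret h: group_hom B G h
    using \<open>h \<in> mon B G\<close> by unfold_locales (simp add: mon_def)
  have inj_f: "inj_on f (carrier A)" and inj_h: "inj_on h (carrier B)"
    using assms(3,4) by (auto simp: mon_def)
  define \<phi> where "\<phi> b = (\<lambda>a \<in> carrier A. inv_into (carrier A) f (h b \<otimes> f a \<otimes> inv (h b)))" for b
  have \<phi>_ext: "\<phi> b \<in> extensional (carrier A)" for b by (simp add: \<phi>_def)
  have \<phi>_cl: "\<phi> b a \<in> carrier A" if "a \<in> carrier A" "b \<in> carrier B" for a b
    using normalizes[OF that] that by (simp add: \<phi>_def inv_into_into)
  have f_\<phi>: "f (\<phi> b a) = h b \<otimes> f a \<otimes> inv (h b)" if "a \<in> carrier A" "b \<in> carrier B" for a b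
    using normalizes[OF that] that by (simp add: \<phi>_def f_inv_into_f)
  have f_eqI: "a = a'" if "f a = f a'" "a \<in> carrier A" "a' \<in> carrier A" for a a'
    using inj_f that by (auto dest: inj_onD)
  have \<phi>_mult: "\<phi> (b \<otimes>\<^bsub>B\<^esub> b') a = \<phi> b (\<phi> b' a)"
    if "a \<in> carrier A" "b \<in> carrier B" "b' \<in> carrier B" for a b b'
    by (rule f_eqI) (use that in \<open>simp_all add: \<phi>_cl f_\<phi> inv_mult_group m_assoc\<close>)
  have \<phi>_one: "\<phi> \<one>\<^bsub>B\<^esub> a = a" if "a \<in> carrier A" for a
    by (rule f_eqI) (use that in \<open>simp_all add: \<phi>_cl f_\<phi>\<close>)
  have \<phi>_auto: "\<phi> b \<in> auto A" if b: "b \<in> carrier B" for b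
  proof -
    have "\<phi> b (a \<otimes>\<^bsub>A\<^esub> a') = \<phi> b a \<otimes>\<^bsub>A\<^esub> \<phi> b a'" if "a \<in> carrier A" "a' \<in> carrier A" for a a'
    proof (rule f_eqI)
      have "inv (h b) \<otimes> (h b \<otimes> z) = z" if "z \<in> carrier G" for z
        using that b by (simp add: m_assoc[symmetric])
      then show "f (\<phi> b (a \<otimes>\<^bsub>A\<^esub> a')) = f (\<phi> b a \<otimes>\<^bsub>A\<^esub> \<phi> b a')"
        using that b by (simp add: \<phi>_cl f_\<phi> m_assoc)
    qed (use that b in \<open>simp_all add: \<phi>_cl\<close>)
    moreover have "bij_betw (\<phi> b) (carrier A) (carrier A)"
      by (rule bij_betw_byWitness[where f' = "\<phi> (inv\<^bsub>B\<^esub> b)"])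
         (use b in \<open>auto simp: \<phi>_cl \<phi>_one \<phi>_mult[symmetric] simp del: h.hom_inv\<close>)
    ultimately show ?thesis
      using b by (auto simp: auto_def Bij_def hom_def \<phi>_cl \<phi>_ext)
  qed
  have \<phi>: "\<phi> \<in> hom B (AutoGroup A)"
  proof (rule homI)
    fix b b' assume b: "b \<in> carrier B" "b' \<in> carrier B"
    have "\<phi> (b \<otimes>\<^bsub>B\<^esub> b') = compose (carrier A) (\<phi> b) (\<phi> b')"
      by (rule extensionalityI[of _ "carrier A"])
         (use b in \<open>simp_all add: \<phi>_ext \<phi>_mult compose_eq compose_extensional\<close>)
    then show "\<phi> (b \<otimes>\<^bsub>B\<^esub> b') = \<phi> b \<otimes>\<^bsub>AutoGroup A\<^esub> \<phi> b'"
      using b by (simp add: AutoGroup_simps \<phi>_auto)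
  qed (simp add: AutoGroup_simps \<phi>_auto)
  define F where "F = (\<lambda>(a, b). f a \<otimes> h b)"
  have "F \<in> hom (A \<rtimes>\<^bsub>\<phi>\<^esub> B) G"
  proof (rule homI)
    fix p q assume "p \<in> carrier (A \<rtimes>\<^bsub>\<phi>\<^esub> B)" "q \<in> carrier (A \<rtimes>\<^bsub>\<phi>\<^esub> B)"
    moreover have "inv (h b) \<otimes> (h b \<otimes> z) = z" if "z \<in> carrier G" "b \<in> carrier B" for z b
      using that by (simp add: m_assoc[symmetric])
    ultimately show "F (p \<otimes>\<^bsub>A \<rtimes>\<^bsub>\<phi>\<^esub> B\<^esub> q) = F p \<otimes> F q"
      by (auto simp: F_def \<phi>_cl f_\<phi> m_assoc)
  qed (auto simp: F_def)
  moreover have "bij_betw F (carrier A \<times> carrier B) (carrier G)"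
  proof -
    have "inj_on F (carrier A \<times> carrier B)"
    proof (rule inj_onI, clarify)
      fix a b a' b' assume c: "a \<in> carrier A" "b \<in> carrier B" "a' \<in> carrier A" "b' \<in> carrier B"
        and "F (a, b) = F (a', b')"
      then have eq: "f a \<otimes> h b = f a' \<otimes> h b'" by (simp add: F_def)
      have "h b \<otimes> inv (h b') = inv (f a) \<otimes> (f a \<otimes> h b) \<otimes> inv (h b')"
        using c by (simp add: m_assoc[symmetric])
      also have "\<dots> = inv (f a) \<otimes> f a'" unfolding eq using c by (simp add: m_assoc)
      finally have eq': "h (b \<otimes>\<^bsub>B\<^esub> inv\<^bsub>B\<^esub> b') = f (inv\<^bsub>A\<^esub> a \<otimes>\<^bsub>A\<^esub> a')" using c by simp
      have "h (b \<otimes>\<^bsub>B\<^esub> inv\<^bsub>B\<^esub> b') = \<one>"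
        by (rule meet) (use c in \<open>simp_all only: eq' B.m_closed B.inv_closed A.m_closed A.inv_closed imageI\<close>)
      then have "h b = h b'" using c by (simp add: inv_solve_right')
      with eq c have "f a = f a'" by simp
      with \<open>h b = h b'\<close> c show "a = a' \<and> b = b'" using inj_f inj_h by (auto dest: inj_onD)
    qed
    moreover from this have "F ` (carrier A \<times> carrier B) = carrier G"
      by (intro card_subset_eq fin)
         (use orders in \<open>auto simp: F_def card_image order_def card_cartesian_product\<close>)
    ultimately show ?thesis by (simp add: bij_betw_def)
  qed
  ultimately have "A \<rtimes>\<^bsub>\<phi>\<^esub> B \<cong> G" by (intro is_isoI[of F]) (simp add: iso_def)
  with \<phi> show ?thesis
    using group.iso_sym[OF group_semidirect_prod[OF assms(1,2) \<phi>]] by blast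
qed

section \<open>Regular groups of affine maps on a cyclic group of odd order\<close>

text \<open>The integers are a principal ideal domain, so such a \<open>K\<close> consists of the multiples of its least positive element.\<close>
lemma difference_closed_principal:
  fixes K :: "int set"
  assumes "m \<in> K" "m > 0" and diff: "\<And>a b. a \<in> K \<Longrightarrow> b \<in> K \<Longrightarrow> a - b \<in> K"
  obtains d where "\<And>c. c \<in> K \<longleftrightarrow> d dvd c"
proof -
  define d where "d = (LEAST j::nat. j > 0 \<and> int j \<in> K)"
  have "nat m > 0 \<and> int (nat m) \<in> K" using assms by simp
  then have d: "d > 0 \<and> int d \<in> K" unfolding d_def by (rule LeastI)
  have least: "d \<le> j" if "j > 0" "int j \<in> K" for j
    unfolding d_def using that by (intro Least_le) simp
  have zero: "0 \<in> K" using diff[OF \<open>m \<in> K\<close> \<open>m \<in> K\<close>] by simp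
  have nat_mult: "c - int j * int d \<in> K \<and> c + int j * int d \<in> K" if "c \<in> K" for c j
  proof (induction j)
    case (Suc j)
    have "0 - int d \<in> K" using diff[OF zero] d by blast
    with Suc diff[of "c - int j * int d" "int d"] diff[of "c + int j * int d" "0 - int d"] d
    show ?case by (simp add: algebra_simps)
  qed (use that in simp)
  have mult: "c - i * int d \<in> K" if "c \<in> K" for c i
    using nat_mult[OF that, of "nat \<bar>i\<bar>"] by (cases "i \<ge> 0") auto
  have "int d dvd c" if "c \<in> K" for c
  proof -
    have "c mod int d = c - (c div int d) * int d" by (simp add: minus_div_mult_eq_mod)
    also have "\<dots> \<in> K" using that by (rule mult)
    finally have "int (nat (c mod int d)) \<in> K" using d by simp
    moreover have "nat (c mod int d) < d" using d by (simp add: nat_less_iff)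
    ultimately have "nat (c mod int d) = 0"
      using least[of "nat (c mod int d)"] by (meson not_le neq0_conv)
    then have "c mod int d = 0" using d by (smt (verit) of_nat_0_less_iff pos_mod_sign nat_0_iff)
    then show ?thesis by blast
  qed
  moreover have "c \<in> K" if "int d dvd c" for c
  proof -
    obtain i where "c = int d * i" using \<open>int d dvd c\<close> by blast
    with mult[OF zero, of "- i"] show ?thesis by (simp add: mult.commute)
  qed
  ultimately show thesis using that by blast
qed

text \<open>
  An element \<open>g\<close> stands for the affine map \<open>y \<mapsto> x g + v g * y\<close> on the integers modulo \<open>n\<close>, and
  \<open>transitive\<close> and \<open>free\<close> say that these maps form a regular permutation group. As \<open>g\<close> sends
  \<open>0\<close> to \<open>x g\<close>, transitivity is expressed by the orbit of \<open>0\<close>. The integers \<open>x g\<close> and \<open>v g\<close> matter only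
  modulo \<open>n\<close>; using integers instead of residues allows reducing them modulo the factors of \<open>n\<close>.
\<close>
locale regular_affine_group = group H for H (structure) +
  fixes n :: nat and x v :: "'a \<Rightarrow> int"
  assumes odd_n: "odd n"
    and x_mult: "\<lbrakk>g \<in> carrier H; h \<in> carrier H\<rbrakk> \<Longrightarrow> [x (g \<otimes> h) = x g + v g * x h] (mod int n)"
    and v_mult: "\<lbrakk>g \<in> carrier H; h \<in> carrier H\<rbrakk> \<Longrightarrow> [v (g \<otimes> h) = v g * v h] (mod int n)"
    and v_coprime: "g \<in> carrier H \<Longrightarrow> coprime (v g) (int n)"
    and transitive: "\<exists>g \<in> carrier H. [x g = a] (mod int n)"
    and free: "\<lbrakk>g \<in> carrier H; [x g + v g * y = y] (mod int n)\<rbrakk> \<Longrightarrow> g = \<one>"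
begin

lemma n_pos: "n > 0"
  using odd_n by (auto intro: Nat.gr0I)

lemma v_one: "[v \<one> = 1] (mod int n)"
proof -
  have "[1 * v \<one> = v \<one> * v \<one>] (mod int n)" using v_mult[of \<one> \<one>] by simp
  then have "[1 = v \<one>] (mod int n)" using v_coprime[of \<one>] by (simp only: cong_mult_rcancel one_closed)
  then show ?thesis by (rule cong_sym)
qed

lemma x_one: "[x \<one> = 0] (mod int n)"
proof -
  have "[x \<one> + 0 = x \<one> + v \<one> * x \<one>] (mod int n)" using x_mult[of \<one> \<one>] by simp
  then have "[v \<one> * 0 = v \<one> * x \<one>] (mod int n)" by (simp only: cong_add_lcancel mult_zero_right)
  then show ?thesis using v_coprime[of \<one>] by (simp only: cong_mult_lcancel one_closed cong_sym_eq)
qed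

text \<open>If \<open>g\<close> and \<open>h\<close> agree at \<open>0\<close>, then \<open>g\<inverse> h\<close> fixes \<open>0\<close>.\<close>
lemma x_eqD:
  assumes g: "g \<in> carrier H" and h: "h \<in> carrier H" and "[x g = x h] (mod int n)"
  shows "g = h"
proof -
  have "[x g + v g * x (inv g \<otimes> h) = x (g \<otimes> (inv g \<otimes> h))] (mod int n)"
    using x_mult[of g "inv g \<otimes> h"] g h by (simp add: cong_sym_eq)
  also have "g \<otimes> (inv g \<otimes> h) = h" using g h by (simp add: m_assoc[symmetric])
  also have "[x h = x g + v g * 0] (mod int n)" using assms(3) by (simp add: cong_sym_eq)
  finally have "[x (inv g \<otimes> h) = 0] (mod int n)"
    using v_coprime[OF g] by (simp only: cong_add_lcancel cong_mult_lcancel)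
  then have "inv g \<otimes> h = \<one>" using g h by (intro free[where y = 0]) simp_all
  then show ?thesis using g h by (simp add: inv_solve_left')
qed

text \<open>Iterating \<open>y \<mapsto> x + v * y\<close> produces the powers of \<open>v\<close> and their partial sums.\<close>
lemma v_pow: "g \<in> carrier H \<Longrightarrow> [v (g [^] j) = v g ^ j] (mod int n)" for j :: nat
proof (induction j)
  case (Suc j)
  then have "[v (g [^] j \<otimes> g) = v (g [^] j) * v g] (mod int n)" by (intro v_mult) auto
  also have "[v (g [^] j) * v g = v g ^ j * v g] (mod int n)" using Suc by (intro cong_scalar_right) auto
  finally show ?case by (simp add: mult.commute)
qed (simp add: v_one)

lemma x_pow: "g \<in> carrier H \<Longrightarrow> [x (g [^] j) = (\<Sum>i<j. v g ^ i) * x g] (mod int n)" for j :: nat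
proof (induction j)
  case (Suc j)
  then have "[x (g [^] j \<otimes> g) = x (g [^] j) + v (g [^] j) * x g] (mod int n)" by (intro x_mult) auto
  also have "[x (g [^] j) + v (g [^] j) * x g = (\<Sum>i<j. v g ^ i) * x g + v g ^ j * x g] (mod int n)"
    using Suc by (intro cong_add cong_scalar_right v_pow) auto
  finally show ?case by (simp add: algebra_simps)
qed (simp add: x_one)

lemma bij_betw_x: "bij_betw (\<lambda>g. x g mod int n) (carrier H) {0..<int n}"
proof (rule bij_betwI')
  fix g h assume "g \<in> carrier H" "h \<in> carrier H"
  then show "x g mod int n = x h mod int n \<longleftrightarrow> g = h" using x_eqD by (auto simp: cong_def)
next
  fix a assume "a \<in> {0..<int n}"
  with transitive[of a] show "\<exists>g\<in>carrier H. a = x g mod int n" by (auto simp: cong_def)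
qed (use n_pos in simp)

lemma finite_carrier: "finite (carrier H)" and order_eq: "order H = n"
  using bij_betw_finite[OF bij_betw_x] bij_betw_same_card[OF bij_betw_x] by (simp_all add: order_def)

text \<open>The amounts of the pure translations in the group. This is an ideal of the integers.\<close>
definition shifts :: "int set" where
  "shifts = {c. \<exists>t \<in> carrier H. [x t = c] (mod int n) \<and> [v t = 1] (mod int n)}"

lemma shifts_diff:
  assumes "a \<in> shifts" "b \<in> shifts"
  shows "a - b \<in> shifts"
proof -
  obtain s t where s: "s \<in> carrier H" "[x s = a] (mod int n)" "[v s = 1] (mod int n)"
    and t: "t \<in> carrier H" "[x t = b] (mod int n)" "[v t = 1] (mod int n)"
    using assms by (auto simp: shifts_def)
  let ?q = "s \<otimes> inv t"
  have q: "?q \<in> carrier H" "?q \<otimes> t = s" using s t by (simp_all add: m_assoc)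
  have "[v ?q * 1 = v ?q * v t] (mod int n)" using t(3) by (intro cong_scalar_left) (simp add: cong_sym_eq)
  also have "[v ?q * v t = v s] (mod int n)" using v_mult[OF q(1) t(1)] q(2) by (simp add: cong_sym_eq)
  finally have vq: "[v ?q = 1] (mod int n)" using s(3) by (metis cong_trans mult.right_neutral)
  have "[x s = x ?q + v ?q * x t] (mod int n)" using x_mult[OF q(1) t(1)] q(2) by simp
  also have "[x ?q + v ?q * x t = x ?q + 1 * b] (mod int n)" by (intro cong_add cong_mult cong_refl vq t(2))
  finally have "[x ?q + b = a] (mod int n)" using s(2) by (metis cong_sym cong_trans mult_1)
  then have "[x ?q = a - b] (mod int n)" by (metis add_diff_cancel_right' cong_diff cong_refl)
  with q(1) vq show ?thesis by (auto simp: shifts_def)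
qed

text \<open>
  The linear parts commute, so \<open>g h\<close> and \<open>h g\<close> differ by a pure translation; its amount is the
  difference of their values at \<open>0\<close>.
\<close>
lemma commutator_translation:
  assumes g: "g \<in> carrier H" and h: "h \<in> carrier H"
  shows "x g + v g * x h - (x h + v h * x g) \<in> shifts"
proof -
  let ?q = "(g \<otimes> h) \<otimes> inv (h \<otimes> g)"
  have q: "?q \<in> carrier H" "?q \<otimes> (h \<otimes> g) = g \<otimes> h" using g h by (simp_all add: m_assoc)
  have "[v ?q * (v h * v g) = v ?q * v (h \<otimes> g)] (mod int n)"
    using v_mult[OF h g] by (intro cong_scalar_left) (simp add: cong_sym_eq)
  also have "[v ?q * v (h \<otimes> g) = v (g \<otimes> h)] (mod int n)"
    using v_mult[OF q(1), of "h \<otimes> g"] q(2) g h by (simp add: cong_sym_eq)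
  also have "[v (g \<otimes> h) = 1 * (v h * v g)] (mod int n)" using v_mult[OF g h] by (simp add: mult.commute)
  finally have vq: "[v ?q = 1] (mod int n)"
    using v_coprime[OF g] v_coprime[OF h] by (simp only: cong_mult_rcancel coprime_mult_left_iff simp_thms)
  have "[x ?q + 1 * (x h + v h * x g) = x ?q + v ?q * x (h \<otimes> g)] (mod int n)"
    using vq x_mult[OF h g] by (intro cong_add cong_mult) (simp_all add: cong_sym_eq)
  also have "[x ?q + v ?q * x (h \<otimes> g) = x (g \<otimes> h)] (mod int n)"
    using x_mult[OF q(1), of "h \<otimes> g"] q(2) g h by (simp add: cong_sym_eq)
  also have "[x (g \<otimes> h) = x g + v g * x h] (mod int n)" using x_mult[OF g h] .
  finally have "[x ?q + (x h + v h * x g) = x g + v g * x h] (mod int n)" by simp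
  then have "[x ?q = x g + v g * x h - (x h + v h * x g)] (mod int n)"
    by (metis add_diff_cancel_right' cong_diff cong_refl)
  with q(1) vq show ?thesis by (auto simp: shifts_def)
qed

text \<open>
  Let \<open>d\<close> generate the ideal of shifts and let \<open>p\<close> be a common prime divisor of \<open>d\<close> and \<open>k\<close>.
  The commutator of \<open>g\<close> with an arbitrary \<open>h\<close> shifts by \<open>(v g - 1) * x h + 1 - v h\<close>, which \<open>p\<close>
  would have to divide. As \<open>v g - 1\<close> is invertible modulo \<open>p\<close>, transitivity yields an \<open>h\<close> with
  \<open>(v g - 1) * x h + 1\<close> divisible by \<open>p\<close>; then \<open>p\<close> divides the unit \<open>v h\<close>. So \<open>d\<close> is coprime
  to \<open>k\<close>, and as a divisor of \<open>n = k * l\<close> it divides \<open>l\<close>.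
\<close>
lemma coprime_part_translation:
  assumes g: "g \<in> carrier H" "[x g = 1] (mod int n)"
    and n: "n = k * l" and cop: "coprime (int k) (v g - 1)"
  shows "int l \<in> shifts"
proof -
  let ?u = "v g"
  have "int n \<in> shifts"
    using x_one v_one by (auto simp: shifts_def cong_def intro!: bexI[of _ \<one>])
  then obtain d where d: "\<And>c. c \<in> shifts \<longleftrightarrow> d dvd c"
    using difference_closed_principal[of "int n" shifts] shifts_diff n_pos by auto
  have "coprime d (int k)"
  proof (rule ccontr)
    assume "\<not> coprime d (int k)"
    then have "gcd d (int k) \<noteq> 0" "\<not> is_unit (gcd d (int k))"
      using n n_pos by (auto simp: is_unit_gcd)
    then obtain p where "prime p" "p dvd gcd d (int k)" using prime_divisor_exists by blast
    then have p: "prime p" "p dvd d" "p dvd int k" by auto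
    then have "p dvd int n" by (simp add: n)
    have "coprime (?u - 1) p" using cop p(3) by (meson coprime_commute coprime_divisors dvd_refl)
    then obtain y where y: "[(?u - 1) * y = 1] (mod p)" using cong_solve_coprime_int by blast
    obtain h where h: "h \<in> carrier H" "[x h = - y] (mod int n)" using transitive by blast
    have "p dvd x g + ?u * x h - (x h + v h * x g)"
      using commutator_translation[OF g(1) h(1)] p(2) d by (meson dvd_trans)
    moreover have "[x g + ?u * x h - (x h + v h * x g) = 1 + ?u * (- y) - (- y + v h * 1)] (mod p)"
      using g(2) h(2) \<open>p dvd int n\<close> by (intro cong_diff cong_add cong_mult cong_refl) (meson cong_dvd_modulus)+
    ultimately have "p dvd 1 + ?u * (- y) - (- y + v h * 1)" by (simp only: cong_dvd_iff)
    moreover have "1 + ?u * (- y) - (- y + v h * 1) = - (((?u - 1) * y - 1) + v h)" by (simp add: algebra_simps)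
    ultimately have "p dvd ((?u - 1) * y - 1) + v h" by (simp only: dvd_minus_iff)
    with y have "p dvd v h" by (simp add: cong_iff_dvd_diff dvd_add_right_iff)
    with v_coprime[OF h(1)] \<open>p dvd int n\<close> have "is_unit p" by (meson coprime_common_divisor)
    with p(1) show False by (meson not_prime_unit)
  qed
  moreover have "d dvd int n" using d \<open>int n \<in> shifts\<close> by blast
  ultimately have "d dvd int l" by (simp add: n coprime_dvd_mult_right_iff)
  then show ?thesis by (simp only: d)
qed

text \<open>
  Let \<open>g\<close> send \<open>0\<close> to \<open>1\<close>, with linear part \<open>u\<close>, and split \<open>n = k * l\<close> so that \<open>u - 1\<close> is
  invertible modulo \<open>k\<close> and divisible by every prime of \<open>l\<close>. Modulo \<open>l\<close>, the powers of \<open>g\<close> move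
  \<open>0\<close> through a cycle of length \<open>l\<close>; modulo \<open>k\<close>, \<open>g\<close> has a fixed point. Together, \<open>g ^ l\<close> has a
  fixed point modulo \<open>n\<close>, so it is trivial by freeness, and \<open>g\<close> has order exactly \<open>l\<close>. The
  translation \<open>t\<close> by \<open>l\<close> belongs to the group and generates a normal subgroup of order \<open>k\<close>, which
  is a complement of the group generated by \<open>g\<close>.
\<close>
theorem iso_semidirect_cyclic:
  obtains k l \<alpha> where "k > 0" "l > 0" "gcd k l = 1" "k * l = n"
    "\<alpha> \<in> hom (integer_mod_group l) (AutoGroup (integer_mod_group k))"
    "H \<cong> integer_mod_group k \<rtimes>\<^bsub>\<alpha>\<^esub> integer_mod_group l"
proof -
  obtain g where g: "g \<in> carrier H" "[x g = 1] (mod int n)" using transitive by blast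
  let ?u = "v g"
  obtain k l where n: "n = k * l" and k: "coprime (int k) (?u - 1)"
    and l: "\<And>p. prime p \<Longrightarrow> p dvd l \<Longrightarrow> int p dvd ?u - 1"
    using split_off_coprime_part[OF n_pos] by metis
  have pos: "k > 0" "l > 0" using n n_pos by auto
  have "odd l" using odd_n n by simp
  note geom = dvd_geometric_sum_iff[OF \<open>odd l\<close> l]
  have gcd: "gcd k l = 1"
  proof (rule ccontr)
    assume "gcd k l \<noteq> 1"
    then obtain p where p: "prime p" "p dvd gcd k l" by (meson prime_factor_nat)
    then have "int p dvd int k" "int p dvd ?u - 1" using l by auto
    with k have "is_unit (int p)" by (meson coprime_common_divisor)
    with p(1) show False by simp
  qed
  obtain t where t: "t \<in> carrier H" "[x t = int l] (mod int n)" "[v t = 1] (mod int n)"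
    using coprime_part_translation[OF g n k] by (auto simp: shifts_def)
  have x_t: "[x (t [^] j) = int j * int l] (mod int n)" for j :: nat
  proof -
    have "[x (t [^] j) = (\<Sum>i<j. v t ^ i) * x t] (mod int n)" by (rule x_pow[OF t(1)])
    also have "[(\<Sum>i<j. v t ^ i) * x t = (\<Sum>i<j. 1 ^ i) * int l] (mod int n)"
      using t by (intro cong_mult cong_sum cong_pow)
    finally show ?thesis by simp
  qed
  have v_t: "[v (t [^] j) = 1] (mod int n)" for j :: nat
    using cong_trans[OF v_pow[OF t(1)] cong_pow[OF t(3)]] by simp
  have "t [^] j = \<one> \<longleftrightarrow> k dvd j" for j :: nat
  proof -
    have "t [^] j = \<one> \<longleftrightarrow> [x (t [^] j) = x \<one>] (mod int n)" using x_eqD t by (metis cong_refl nat_pow_closed one_closed)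
    also have "\<dots> \<longleftrightarrow> [int j * int l = 0] (mod int n)" using x_t[of j] x_one by (meson cong_sym cong_trans)
    also have "\<dots> \<longleftrightarrow> k dvd j" using pos by (simp add: n cong_0_iff)
    finally show ?thesis .
  qed
  then have ord_t: "ord t = k" using t(1) by (metis ord_unique)
  have x_g: "[x (g [^] j) = (\<Sum>i<j. ?u ^ i)] (mod int n)" for j :: nat
    using cong_trans[OF x_pow[OF g(1)] cong_scalar_left[OF g(2)]] by simp
  have "g [^] l = \<one>"
  proof -
    \<comment> \<open>\<open>y\<close> is the fixed point of \<open>g\<close> modulo \<open>k\<close>; \<open>g ^ l\<close> fixes everything modulo \<open>l\<close>\<close>
    obtain y where y: "[(?u - 1) * y = - 1] (mod int k)"
    proof -
      have "coprime (?u - 1) (int k)" using k by (simp add: coprime_commute)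
      then obtain z where "[(?u - 1) * z = 1] (mod int k)" using cong_solve_coprime_int by blast
      then have "[(?u - 1) * (- z) = - 1] (mod int k)" by (metis cong_minus_minus_iff mult_minus_right)
      then show thesis by (rule that)
    qed
    have "int l * int k dvd (\<Sum>i<l. ?u ^ i) * ((?u - 1) * y + 1)"
      using geom[of l] y by (intro mult_dvd_mono) (auto simp: cong_iff_dvd_diff)
    also have "(\<Sum>i<l. ?u ^ i) * ((?u - 1) * y + 1) = ((?u - 1) * (\<Sum>i<l. ?u ^ i)) * y + (\<Sum>i<l. ?u ^ i)"
      by (simp add: algebra_simps)
    also have "\<dots> = (\<Sum>i<l. ?u ^ i) + ?u ^ l * y - y"
      unfolding power_diff_1_eq[symmetric] by (simp add: algebra_simps)
    finally have "[(\<Sum>i<l. ?u ^ i) + ?u ^ l * y = y] (mod int n)"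
      by (simp add: cong_iff_dvd_diff n mult.commute)
    moreover have "[x (g [^] l) + v (g [^] l) * y = (\<Sum>i<l. ?u ^ i) + ?u ^ l * y] (mod int n)"
      by (intro cong_add cong_scalar_right x_g v_pow g(1))
    ultimately show ?thesis by (intro free[where y = y]) (auto simp: g(1) intro: cong_trans)
  qed
  \<comment> \<open>used with \<open>c = 0\<close> for the order of \<open>g\<close>, and for powers of \<open>g\<close> that are powers of \<open>t\<close>\<close>
  moreover have l_dvd: "l dvd j" if "[x (g [^] j) = c * int l] (mod int n)" for j :: nat and c
  proof -
    have "[(\<Sum>i<j. ?u ^ i) = c * int l] (mod int l)"
      using cong_trans[OF cong_sym[OF x_g] that] by (rule cong_dvd_modulus) (simp add: n)
    then have "int l dvd (\<Sum>i<j. ?u ^ i)" by (simp add: cong_dvd_iff)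
    then show ?thesis using geom by blast
  qed
  ultimately have pow_g: "g [^] j = \<one> \<longleftrightarrow> l dvd j" for j :: nat
    using l_dvd[of j 0] x_one g(1) by (auto simp: nat_pow_pow[symmetric])
  then have ord_g: "ord g = l" using g(1) by (metis ord_unique)
  have "\<exists>\<alpha> \<in> hom (integer_mod_group l) (AutoGroup (integer_mod_group k)).
          H \<cong> integer_mod_group k \<rtimes>\<^bsub>\<alpha>\<^esub> integer_mod_group l"
  proof (rule iso_semidirect_prod)
    show "(\<lambda>c::int. t [^] c) \<in> mon (integer_mod_group k) H"
      "(\<lambda>c::int. g [^] c) \<in> mon (integer_mod_group l) H"
      using t(1) g(1) ord_t ord_g pos by (auto intro: int_pow_mon_integer_mod_group)
    show "order (integer_mod_group k) * order (integer_mod_group l) = order H"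
      using pos unfolding order_eq by (simp add: order_def carrier_integer_mod_group n)
  next
    fix a b assume a: "a \<in> carrier (integer_mod_group k)" and "b \<in> carrier (integer_mod_group l)"
    define h where "h = g [^] b"
    have h: "h \<in> carrier H" using g(1) by (simp add: h_def)
    obtain i where i: "a = int i" using a pos by (auto simp: carrier_integer_mod_group intro: nonneg_int_cases)
    \<comment> \<open>conjugation by \<open>h\<close> multiplies the amount of a translation by the linear part of \<open>h\<close>\<close>
    define j where "j = nat (v h * a mod int k)"
    have j: "int j = v h * a mod int k" using pos by (simp add: j_def)
    have "[x (t [^] j \<otimes> h) = x (t [^] j) + v (t [^] j) * x h] (mod int n)" using t h by (intro x_mult) auto
    also have "[x (t [^] j) + v (t [^] j) * x h = int j * int l + 1 * x h] (mod int n)"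
      by (intro cong_add cong_mult cong_refl x_t v_t)
    also have "[int j * int l + 1 * x h = x h + v h * (a * int l)] (mod int n)"
    proof -
      have "int n dvd (int j - v h * a) * int l"
        by (simp add: n j mult_dvd_mono flip: mod_eq_dvd_iff)
      then show ?thesis by (simp add: cong_iff_dvd_diff algebra_simps)
    qed
    also have "[x h + v h * (a * int l) = x h + v h * x (t [^] i)] (mod int n)"
      unfolding i by (intro cong_add cong_mult cong_refl cong_sym[OF x_t])
    also have "[x h + v h * x (t [^] i) = x (h \<otimes> t [^] i)] (mod int n)"
      using t h by (intro cong_sym[OF x_mult]) auto
    finally have "t [^] j \<otimes> h = h \<otimes> t [^] i" using t h by (intro x_eqD) auto
    then have "h \<otimes> t [^] a \<otimes> inv h = t [^] int j" using t h
      by (metis i int_pow_int inv_solve_right m_closed nat_pow_closed)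
    moreover have "int j \<in> carrier (integer_mod_group k)" using pos by (simp add: j carrier_integer_mod_group)
    ultimately show "g [^] b \<otimes> t [^] a \<otimes> inv (g [^] b) \<in> (\<lambda>c. t [^] c) ` carrier (integer_mod_group k)"
      unfolding h_def by blast
  next
    fix b assume b: "b \<in> carrier (integer_mod_group l)"
      and "g [^] b \<in> (\<lambda>c. t [^] c) ` carrier (integer_mod_group k)"
    then obtain c where c: "c \<in> carrier (integer_mod_group k)" "g [^] b = t [^] c" by blast
    obtain i j where i: "c = int i" and j: "b = int j"
      using b c(1) pos by (auto simp: carrier_integer_mod_group elim!: nonneg_int_cases)
    have "l dvd j" using x_t[of i] c(2) by (intro l_dvd) (simp add: i j int_pow_int)
    then show "g [^] b = \<one>" by (simp add: j int_pow_int pow_g)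
  qed (simp_all add: finite_carrier)
  then obtain \<alpha> where "\<alpha> \<in> hom (integer_mod_group l) (AutoGroup (integer_mod_group k))"
    "H \<cong> integer_mod_group k \<rtimes>\<^bsub>\<alpha>\<^esub> integer_mod_group l" ..
  with that[OF pos gcd n[symmetric]] show thesis .
qed

end

section \<open>Splitting off a factor of order two\<close>

text \<open>
  If \<open>\<pi> s = 1\<close>, then \<open>t = s ^ n\<close> still satisfies \<open>\<pi> t = 1\<close> because \<open>n\<close> is odd, and \<open>t\<^sup>2 = \<one>\<close>
  because the group has order \<open>2 * n\<close>. So \<open>t\<close> generates a complement of the kernel of \<open>\<pi>\<close>.
\<close>
lemma (in group) iso_semidirect_prod_two:
  fixes A :: "('c, 'm) monoid_scheme"
  assumes "group A" and \<pi>: "\<pi> \<in> hom G (integer_mod_group 2)" and s: "s \<in> carrier G" "\<pi> s = 1"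
    and "A \<cong> G\<lparr>carrier := {g \<in> carrier G. \<pi> g = 0}\<rparr>"
    and "odd n" "order A = n" "order G = 2 * n"
  shows "\<exists>\<beta> \<in> hom (integer_mod_group 2) (AutoGroup A). G \<cong> A \<rtimes>\<^bsub>\<beta>\<^esub> integer_mod_group 2"
proof -
  interpret \<pi>: group_hom G "integer_mod_group 2" \<pi>
    using \<pi> by (intro group_hom.intro group_hom_axioms.intro) simp_all
  obtain f where f: "f \<in> hom A (G\<lparr>carrier := {g \<in> carrier G. \<pi> g = 0}\<rparr>)" "inj_on f (carrier A)"
    and f_img: "f ` carrier A = {g \<in> carrier G. \<pi> g = 0}"
    using assms(5) by (auto simp: is_iso_def iso_def bij_betw_def)
  define t where "t = s [^] n"
  have "int n mod 2 = 1" using \<open>odd n\<close> by presburger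
  then have t: "t \<in> carrier G" "\<pi> t = 1"
    using s by (simp_all add: t_def \<pi>.hom_nat_pow)
  have "t [^] (2::nat) = \<one>"
    using s(1) pow_order_eq_1[OF s(1)] assms(8) by (simp add: t_def nat_pow_pow mult.commute)
  then have "ord t dvd 2" using t(1) by (simp add: pow_eq_id)
  moreover have "ord t \<noteq> 1" using t ord_eq_1[OF t(1)] by auto
  ultimately have ord_t: "ord t = 2" using two_is_prime_nat by (metis prime_nat_iff)
  show ?thesis
  proof (rule iso_semidirect_prod)
    show "f \<in> mon A G" using f by (auto simp: mon_def hom_def)
    show "(\<lambda>c::int. t [^] c) \<in> mon (integer_mod_group 2) G"
      using t(1) ord_t by (rule int_pow_mon_integer_mod_group) simp
    show "order A * order (integer_mod_group 2) = order G"
      using assms(7,8) by (simp add: order_def carrier_integer_mod_group)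
    have "order G > 0" using assms(8) \<open>odd n\<close> by (auto intro: Nat.gr0I)
    then show "finite (carrier G)" by (simp add: order_gt_0_iff_finite)
  next
    fix a b assume a: "a \<in> carrier A" and "b \<in> carrier (integer_mod_group 2)"
    have fa: "f a \<in> carrier G" "\<pi> (f a) = 0" using a f_img by auto
    define h where "h = t [^] b"
    have h: "h \<in> carrier G" using t(1) by (simp add: h_def)
    have "\<pi> (h \<otimes> f a \<otimes> inv h) = (\<pi> h + \<pi> (inv h)) mod 2"
      using h fa by (simp add: mod_simps del: \<pi>.hom_inv)
    also have "\<dots> = \<pi> (h \<otimes> inv h)" using h by (subst \<pi>.hom_mult) simp_all
    finally have "\<pi> (h \<otimes> f a \<otimes> inv h) = 0" using h by (simp only: r_inv \<pi>.hom_one one_integer_mod_group)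
    then show "t [^] b \<otimes> f a \<otimes> inv (t [^] b) \<in> f ` carrier A"
      using h fa by (simp add: f_img flip: h_def)
  next
    fix b assume "b \<in> carrier (integer_mod_group 2)" "t [^] b \<in> f ` carrier A"
    then have "b = 0 \<or> b = 1" "\<pi> (t [^] b) = 0" by (auto simp: carrier_integer_mod_group f_img)
    with t show "t [^] b = \<one>" by auto
  qed (simp_all add: assms)
qed

section \<open>The holomorph of a cyclic group of odd order extended by two\<close>

locale cyclic_by_two =
  fixes n :: nat and \<theta> :: "int \<Rightarrow> int \<Rightarrow> int"
  assumes odd_n: "odd n"
    and \<theta>: "\<theta> \<in> hom (integer_mod_group 2) (AutoGroup (integer_mod_group n))"
begin

abbreviation "N \<equiv> integer_mod_group n \<rtimes>\<^bsub>\<theta>\<^esub> integer_mod_group 2"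

lemma n_pos: "n > 0"
  using odd_n by (auto intro: Nat.gr0I)

sublocale N: group N
  by (rule group_semidirect_prod[OF _ _ \<theta>]) simp_all

lemma carrier_N: "carrier N = {0..<int n} \<times> {0, 1}"
  using n_pos by (auto simp: carrier_integer_mod_group)

lemma \<theta>_zero: "a \<in> {0..<int n} \<Longrightarrow> \<theta> 0 a = a"
proof -
  assume a: "a \<in> {0..<int n}"
  have "group (AutoGroup (integer_mod_group n))" by (simp add: group.AutoGroup)
  then have "\<theta> 0 = \<one>\<^bsub>AutoGroup (integer_mod_group n)\<^esub>"
    using hom_one[OF \<theta>] by simp
  with a n_pos show ?thesis by (simp add: AutoGroup_simps carrier_integer_mod_group)
qed

lemma mult_zero: "a' \<in> {0..<int n} \<Longrightarrow> (a, 0) \<otimes>\<^bsub>N\<^esub> (a', b) = ((a + a') mod int n, b mod 2)"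
  by (simp add: \<theta>_zero)

lemma pow_zero:
  fixes j :: nat
  assumes "a \<in> {0..<int n}"
  shows "(a, 0) [^]\<^bsub>N\<^esub> j = (int j * a mod int n, 0)"
proof (induction j)
  case (Suc j)
  have "(int j * a mod int n, 0) \<otimes>\<^bsub>N\<^esub> (a, 0) = ((int j * a mod int n + a) mod int n, 0 mod 2)"
    using assms by (rule mult_zero)
  with Suc show ?case by (simp add: mod_simps algebra_simps del: semidirect_prod_simps)
qed simp

lemma snd_hom: "snd \<in> hom N (integer_mod_group 2)"
  by (rule homI) auto

text \<open>
  Since \<open>n\<close> is odd, the \<open>n\<close>-th power map detects the second component, so the cyclic normal factor
  consists of the solutions of \<open>y ^ n = \<one>\<close>. Every automorphism therefore preserves that factor and, its
  index being two, also its other coset.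
\<close>
lemma snd_pow:
  assumes "y \<in> carrier N"
  shows "snd (y [^]\<^bsub>N\<^esub> n) = snd y"
proof -
  interpret s: group_hom N "integer_mod_group 2" snd
    using snd_hom by (intro group_hom.intro group_hom_axioms.intro) simp_all
  have "snd (y [^]\<^bsub>N\<^esub> n) = int n * snd y mod 2"
    using s.hom_nat_pow[OF assms, of n] by simp
  also have "\<dots> = (int n mod 2) * snd y mod 2" by (simp add: mod_simps)
  also have "int n mod 2 = 1" using odd_n by presburger
  finally show ?thesis using assms by (auto simp: carrier_N simp del: semidirect_prod_simps)
qed

lemma pow_eq_one_iff:
  assumes "y \<in> carrier N"
  shows "y [^]\<^bsub>N\<^esub> n = \<one>\<^bsub>N\<^esub> \<longleftrightarrow> snd y = 0"
proof
  assume "y [^]\<^bsub>N\<^esub> n = \<one>\<^bsub>N\<^esub>"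
  then show "snd y = 0" using snd_pow[OF assms] by simp
next
  assume "snd y = 0"
  moreover have "fst y \<in> {0..<int n}" using assms by (auto simp: carrier_N simp del: semidirect_prod_simps)
  ultimately show "y [^]\<^bsub>N\<^esub> n = \<one>\<^bsub>N\<^esub>" using pow_zero[of "fst y" n] by (cases y) simp
qed

lemma auto_pow:
  fixes j :: nat
  assumes "\<alpha> \<in> auto N" "y \<in> carrier N"
  shows "\<alpha> (y [^]\<^bsub>N\<^esub> j) = \<alpha> y [^]\<^bsub>N\<^esub> j"
proof -
  have "group_hom N N \<alpha>" using assms(1) by unfold_locales (simp add: auto_def)
  then show ?thesis using assms(2) by (rule group_hom.hom_nat_pow)
qed

lemma snd_auto:
  assumes \<alpha>: "\<alpha> \<in> auto N" and y: "y \<in> carrier N"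
  shows "snd (\<alpha> y) = snd y"
proof -
  have \<alpha>y: "\<alpha> y \<in> carrier N" using assms by (rule auto_closed)
  have "snd (\<alpha> y) = 0 \<longleftrightarrow> \<alpha> (y [^]\<^bsub>N\<^esub> n) = \<alpha> \<one>\<^bsub>N\<^esub>"
    using pow_eq_one_iff[OF \<alpha>y] auto_pow[OF assms, of n] auto_one[OF N.is_group \<alpha>] by simp
  also have "\<dots> \<longleftrightarrow> y [^]\<^bsub>N\<^esub> n = \<one>\<^bsub>N\<^esub>"
    using y by (intro inj_on_eq_iff[OF bij_betw_imp_inj_on[OF auto_bij[OF \<alpha>]]])
      (simp_all del: semidirect_prod_simps)
  also have "\<dots> \<longleftrightarrow> snd y = 0" by (rule pow_eq_one_iff[OF y])
  finally show ?thesis using y \<alpha>y by (auto simp: carrier_N mem_Times_iff simp del: semidirect_prod_simps)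
qed

text \<open>
  The argument is the generator of the cyclic factor; it is written \<open>1 mod n\<close> because the factor is
  \<open>{0}\<close> when \<open>n = 1\<close>.
\<close>
definition mult_by :: "(int \<times> int \<Rightarrow> int \<times> int) \<Rightarrow> int" where
  "mult_by \<alpha> = fst (\<alpha> (1 mod int n, 0))"

lemma auto_zero:
  assumes \<alpha>: "\<alpha> \<in> auto N" and a: "a \<in> {0..<int n}"
  shows "\<alpha> (a, 0) = (mult_by \<alpha> * a mod int n, 0)"
proof -
  let ?e = "(1 mod int n, 0)"
  have e: "?e \<in> carrier N" using n_pos by (auto simp: carrier_N simp del: semidirect_prod_simps)
  have "(a, 0) = ?e [^]\<^bsub>N\<^esub> nat a"
    using pow_zero[of "1 mod int n" "nat a"] a n_pos by (simp add: mod_simps)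
  then have "\<alpha> (a, 0) = \<alpha> ?e [^]\<^bsub>N\<^esub> nat a" using auto_pow[OF \<alpha> e] by simp
  also have "\<alpha> ?e = (mult_by \<alpha>, 0)"
    using snd_auto[OF \<alpha> e] by (simp add: mult_by_def prod_eq_iff)
  also have "(mult_by \<alpha>, 0) [^]\<^bsub>N\<^esub> nat a = (int (nat a) * mult_by \<alpha> mod int n, 0)"
    using auto_closed[OF \<alpha> e] 
    by (intro pow_zero) (auto simp: mult_by_def carrier_N mem_Times_iff simp del: semidirect_prod_simps)
  finally show ?thesis using a by (simp add: mult.commute)
qed

text \<open>With a common divisor \<open>d > 1\<close>, the automorphism would send \<open>n / d\<close> to \<open>0\<close>.\<close>
lemma mult_by_coprime:
  assumes \<alpha>: "\<alpha> \<in> auto N"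
  shows "coprime (mult_by \<alpha>) (int n)"
proof (rule ccontr)
  let ?d = "gcd (mult_by \<alpha>) (int n)"
  assume "\<not> coprime (mult_by \<alpha>) (int n)"
  moreover have "?d > 0" using n_pos by simp
  ultimately have d: "?d > 1" unfolding coprime_iff_gcd_eq_1 by linarith
  obtain m where m: "int n = ?d * m" by (meson dvdE gcd_dvd2)
  have "m > 0" using m n_pos \<open>?d > 0\<close> by (metis of_nat_0_less_iff zero_less_mult_pos)
  then have "m < int n" using d m by (metis mult_less_cancel_right2 not_less_iff_gr_or_eq mult_strict_right_mono mult_1)
  have "int n dvd mult_by \<alpha> * m" by (subst m) (simp add: mult_dvd_mono)
  then have "\<alpha> (m, 0) = \<alpha> (0, 0)"
    using auto_zero[OF \<alpha>, of m] auto_zero[OF \<alpha>, of 0] \<open>m > 0\<close> \<open>m < int n\<close> by simp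
  moreover have "(m, 0) \<in> carrier N" "(0, 0) \<in> carrier N"
    using \<open>m > 0\<close> \<open>m < int n\<close> by (auto simp: carrier_N simp del: semidirect_prod_simps)
  ultimately have "(m, 0) = (0 :: int, 0 :: int)"
    using auto_bij[OF \<alpha>] by (meson bij_betw_imp_inj_on inj_onD)
  with \<open>m > 0\<close> show False by simp
qed

lemma carrier_Hol: "carrier (Hol N) = ({0..<int n} \<times> {0, 1}) \<times> auto N"
proof -
  have "carrier (Hol N) = carrier N \<times> carrier (AutoGroup N)"
    unfolding Hol_def by (rule semidirect_prod_simps(1))
  then show ?thesis by (simp only: AutoGroup_simps(1) carrier_N)
qed

lemma mult_Hol:
  assumes "(p, \<alpha>) \<in> carrier (Hol N)" "(q, \<beta>) \<in> carrier (Hol N)"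
  shows "(p, \<alpha>) \<otimes>\<^bsub>Hol N\<^esub> (q, \<beta>) = (p \<otimes>\<^bsub>N\<^esub> \<alpha> q, compose (carrier N) \<alpha> \<beta>)"
  using assms by (auto simp: Hol_def AutoGroup_simps)

text \<open>This is the action of the holomorph on the two cosets of the cyclic factor.\<close>
lemma parity_hom: "(\<lambda>P. snd (fst P)) \<in> hom (Hol N) (integer_mod_group 2)"
proof (rule homI)
  fix P Q assume PQ: "P \<in> carrier (Hol N)" "Q \<in> carrier (Hol N)"
  then obtain p \<alpha> q \<beta> where eqs: "P = (p, \<alpha>)" "Q = (q, \<beta>)" by (metis surj_pair)
  have "snd (\<alpha> q) = snd q"
    using PQ by (intro snd_auto) (auto simp: eqs carrier_Hol carrier_N simp del: semidirect_prod_simps)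
  then show "snd (fst (P \<otimes>\<^bsub>Hol N\<^esub> Q)) = snd (fst P) \<otimes>\<^bsub>integer_mod_group 2\<^esub> snd (fst Q)"
    unfolding eqs using PQ by (subst mult_Hol) (simp_all add: eqs case_prod_beta semidirect_prod_def)
qed (auto simp: carrier_Hol carrier_integer_mod_group)

text \<open>
  The elements of \<open>R\<close> of parity \<open>0\<close> are those that preserve the cyclic factor as a set. They act on it
  by affine maps, and regularity is inherited: an element of \<open>R\<close> that moves one point of the factor to
  another has parity \<open>0\<close>.
\<close>
lemma regular_affine_group_even_part:
  assumes R: "regular_subgroup R N"
  shows "regular_affine_group (Hol N\<lparr>carrier := {P \<in> R. snd (fst P) = 0}\<rparr>) n
           (\<lambda>P. fst (fst P)) (\<lambda>P. mult_by (snd P))"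
proof -
  let ?M = "Hol N\<lparr>carrier := R\<rparr>"
  let ?H = "{P \<in> R. snd (fst P) = 0}"
  have subR: "subgroup R (Hol N)" using R by (simp add: regular_subgroup_def)
  interpret Hol: group "Hol N" by (rule group_Hol) (rule N.is_group)
  interpret s: group_hom "Hol N" "integer_mod_group 2" "\<lambda>P. snd (fst P)"
    using parity_hom by (intro group_hom.intro group_hom_axioms.intro) simp_all
  have "?H = R \<inter> kernel (Hol N) (integer_mod_group 2) (\<lambda>P. snd (fst P))"
    using subgroup.subset[OF subR] by (auto simp: kernel_def)
  then have subH: "subgroup ?H (Hol N)"
    using Hol.subgroups_Inter_pair[OF subR s.subgroup_kernel] by simp
  interpret H: group "Hol N\<lparr>carrier := ?H\<rparr>" by (rule Hol.subgroup_imp_group[OF subH])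
  have elem: "\<exists>a \<alpha>. P = ((a, 0), \<alpha>) \<and> a \<in> {0..<int n} \<and> \<alpha> \<in> auto N" if "P \<in> ?H" for P
    using that subgroup.subset[OF subR] by (auto simp: carrier_Hol)
  have mult: "((a, 0), \<alpha>) \<otimes>\<^bsub>Hol N\<^esub> ((b, 0), \<beta>) =
      (((a + mult_by \<alpha> * b) mod int n, 0), compose (carrier N) \<alpha> \<beta>)"
    if "a \<in> {0..<int n}" "\<alpha> \<in> auto N" "b \<in> {0..<int n}" "\<beta> \<in> auto N" for a b \<alpha> \<beta>
    using that n_pos
    by (subst mult_Hol) (simp_all add: carrier_Hol auto_zero mult_zero mod_simps del: semidirect_prod_simps)
  have comp: "mult_by (compose (carrier N) \<alpha> \<beta>) = mult_by \<alpha> * mult_by \<beta> mod int n"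
    if "\<alpha> \<in> auto N" "\<beta> \<in> auto N" for \<alpha> \<beta>
  proof -
    have "(1 mod int n, 0) \<in> carrier N" using n_pos by (simp add: carrier_N del: semidirect_prod_simps)
    then show ?thesis
      using n_pos that
      by (simp add: mult_by_def[of "compose _ _ _"] compose_eq auto_zero mod_simps del: semidirect_prod_simps)
  qed
  show ?thesis
  proof
    show "odd n" by (rule odd_n)
  next
    fix P Q assume "P \<in> carrier (Hol N\<lparr>carrier := ?H\<rparr>)" "Q \<in> carrier (Hol N\<lparr>carrier := ?H\<rparr>)"
    then obtain a \<alpha> b \<beta> where eqs: "P = ((a, 0), \<alpha>)" "Q = ((b, 0), \<beta>)"
      and c: "a \<in> {0..<int n}" "\<alpha> \<in> auto N" "b \<in> {0..<int n}" "\<beta> \<in> auto N"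
      using elem[of P] elem[of Q] by auto
    show "[fst (fst (P \<otimes>\<^bsub>Hol N\<lparr>carrier := ?H\<rparr>\<^esub> Q)) = fst (fst P) + mult_by (snd P) * fst (fst Q)] (mod int n)"
      using mult[OF c] by (simp add: eqs cong_def)
    show "[mult_by (snd (P \<otimes>\<^bsub>Hol N\<lparr>carrier := ?H\<rparr>\<^esub> Q)) = mult_by (snd P) * mult_by (snd Q)] (mod int n)"
      using mult[OF c] comp[OF c(2,4)] by (simp add: eqs cong_def)
  next
    fix P assume "P \<in> carrier (Hol N\<lparr>carrier := ?H\<rparr>)"
    then show "coprime (mult_by (snd P)) (int n)" using elem[of P] by (auto intro: mult_by_coprime)
  next
    fix a :: int
    have "\<one>\<^bsub>N\<^esub> \<in> carrier N" "(a mod int n, 0) \<in> carrier N"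
      using n_pos by (simp_all add: carrier_N del: semidirect_prod_simps(1))
    then obtain P where P: "P \<in> R" "Hol_act N P \<one>\<^bsub>N\<^esub> = (a mod int n, 0)"
      using R transitive_action.unique_orbit[of ?M "carrier N" "Hol_act N" "\<one>\<^bsub>N\<^esub>" "(a mod int n, 0)"]
      by (auto simp: regular_subgroup_def)
    have "Hol_act N P \<one>\<^bsub>N\<^esub> = fst P"
    proof -
      have "snd P \<in> auto N" "fst P \<in> carrier N"
        using P(1) subgroup.subset[OF subR] by (auto simp: carrier_Hol carrier_N simp del: semidirect_prod_simps)
      then show ?thesis by (simp add: Hol_act_def case_prod_beta auto_one[OF N.is_group] del: semidirect_prod_simps)
    qed
    with P(2) have "fst P = (a mod int n, 0)" by (simp del: semidirect_prod_simps)
    with P(1) show "\<exists>P\<in>carrier (Hol N\<lparr>carrier := ?H\<rparr>). [fst (fst P) = a] (mod int n)"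
      by (intro bexI[of _ P]) auto
  next
    fix P y assume P: "P \<in> carrier (Hol N\<lparr>carrier := ?H\<rparr>)"
      and fix_y: "[fst (fst P) + mult_by (snd P) * y = y] (mod int n)"
    then obtain a \<alpha> where eqs: "P = ((a, 0), \<alpha>)" and c: "a \<in> {0..<int n}" "\<alpha> \<in> auto N"
      using elem[of P] by auto
    have y: "(y mod int n, 0) \<in> carrier N" using n_pos by (simp add: carrier_N del: semidirect_prod_simps)
    have "Hol_act N P (y mod int n, 0) = (y mod int n, 0)"
      using y c n_pos fix_y
      by (simp add: eqs Hol_act_def auto_zero mult_zero mod_simps cong_def del: semidirect_prod_simps)
    then have "P \<in> stabilizer ?M (Hol_act N) (y mod int n, 0)" using P by (simp add: stabilizer_def)
    with R y show "P = \<one>\<^bsub>Hol N\<lparr>carrier := ?H\<rparr>\<^esub>" by (auto simp: regular_subgroup_def)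
  qed
qed

lemma regular_odd_element:
  assumes R: "regular_subgroup R N"
  obtains P where "P \<in> R" "snd (fst P) = 1"
proof -
  have "(0, 0) \<in> carrier N" "(0, 1) \<in> carrier N"
    using n_pos by (simp_all add: carrier_N del: semidirect_prod_simps)
  then obtain P where P: "P \<in> R" "Hol_act N P (0, 0) = (0, 1)"
    using R transitive_action.unique_orbit[of "Hol N\<lparr>carrier := R\<rparr>" "carrier N" "Hol_act N" "(0, 0)" "(0, 1)"]
    by (auto simp: regular_subgroup_def)
  have c: "snd P \<in> auto N" "fst P \<in> carrier N"
    using P(1) subgroup.subset[of R "Hol N"] R
    by (auto simp: regular_subgroup_def carrier_Hol carrier_N simp del: semidirect_prod_simps)
  have "snd P \<one>\<^bsub>N\<^esub> = \<one>\<^bsub>N\<^esub>" using c by (intro auto_one[OF N.is_group])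
  then have "Hol_act N P \<one>\<^bsub>N\<^esub> = fst P"
    using c by (simp add: Hol_act_def case_prod_beta del: semidirect_prod_simps)
  with P(2) have "fst P = (0, 1)" by simp
  with P(1) that show thesis by simp
qed

end

theorem theorem3p3:
  fixes n :: nat and \<theta> :: "int \<Rightarrow> int \<Rightarrow> int" and G :: "('g, 'm) monoid_scheme"
  assumes "odd n"
    and "\<theta> \<in> hom (integer_mod_group 2) (AutoGroup (integer_mod_group n))"
    and "group G" and "order G = 2 * n"
    and "realizable G (integer_mod_group n \<rtimes>\<^bsub>\<theta>\<^esub> integer_mod_group 2)"
  shows "\<exists>k l :: nat. k > 0 \<and> l > 0 \<and> gcd k l = 1 \<and> k * l = n \<and>
    (\<exists>\<alpha> \<beta>. \<alpha> \<in> hom (integer_mod_group l) (AutoGroup (integer_mod_group k)) \<and>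
      \<beta> \<in> hom (integer_mod_group 2)
              (AutoGroup (integer_mod_group k \<rtimes>\<^bsub>\<alpha>\<^esub> integer_mod_group l)) \<and>
      G \<cong> (integer_mod_group k \<rtimes>\<^bsub>\<alpha>\<^esub> integer_mod_group l) \<rtimes>\<^bsub>\<beta>\<^esub> integer_mod_group 2)"
proof -
  interpret cyclic_by_two n \<theta> using assms(1,2) by unfold_locales
  obtain R where R: "regular_subgroup R N" and G_iso: "G \<cong> Hol N\<lparr>carrier := R\<rparr>"
    using assms(5) by (auto simp: realizable_def)
  let ?M = "Hol N\<lparr>carrier := R\<rparr>"
  let ?H = "{P \<in> R. snd (fst P) = 0}"
  have subR: "subgroup R (Hol N)" using R by (simp add: regular_subgroup_def)
  interpret Hol: group "Hol N" by (rule group_Hol) (rule N.is_group)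
  interpret M: group ?M by (rule Hol.subgroup_imp_group[OF subR])
  interpret H: regular_affine_group "Hol N\<lparr>carrier := ?H\<rparr>" n "\<lambda>P. fst (fst P)" "\<lambda>P. mult_by (snd P)"
    by (rule regular_affine_group_even_part[OF R])
  obtain k l \<alpha> where kl: "k > 0" "l > 0" "gcd k l = 1" "k * l = n"
    and \<alpha>: "\<alpha> \<in> hom (integer_mod_group l) (AutoGroup (integer_mod_group k))"
    and iso: "Hol N\<lparr>carrier := ?H\<rparr> \<cong> integer_mod_group k \<rtimes>\<^bsub>\<alpha>\<^esub> integer_mod_group l"
    by (rule H.iso_semidirect_cyclic)
  let ?A = "integer_mod_group k \<rtimes>\<^bsub>\<alpha>\<^esub> integer_mod_group l"
  obtain P where P: "P \<in> R" "snd (fst P) = 1" using regular_odd_element[OF R] .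
  have "\<exists>\<beta> \<in> hom (integer_mod_group 2) (AutoGroup ?A). ?M \<cong> ?A \<rtimes>\<^bsub>\<beta>\<^esub> integer_mod_group 2"
  proof (rule M.iso_semidirect_prod_two)
    show "group ?A" using \<alpha> by (intro group_semidirect_prod) simp_all
    show "(\<lambda>P. snd (fst P)) \<in> hom ?M (integer_mod_group 2)"
      using parity_hom subgroup.subset[OF subR] by (auto simp: hom_def Pi_iff)
    show "?A \<cong> ?M\<lparr>carrier := {P \<in> carrier ?M. snd (fst P) = 0}\<rparr>"
      using H.iso_sym[OF iso] by simp
    show "order ?A = n"
      using kl by (simp add: order_def card_cartesian_product carrier_integer_mod_group)
    show "order ?M = 2 * n" using iso_same_card[OF G_iso] assms(4) by (simp add: order_def)
  qed (use P assms(1) in simp_all)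
  then obtain \<beta> where \<beta>: "\<beta> \<in> hom (integer_mod_group 2) (AutoGroup ?A)"
    and M_iso: "?M \<cong> ?A \<rtimes>\<^bsub>\<beta>\<^esub> integer_mod_group 2" by blast
  show ?thesis
    by (rule exI[of _ k], rule exI[of _ l], intro conjI exI[of _ \<alpha>] exI[of _ \<beta>])
       (use kl \<alpha> \<beta> iso_trans[OF G_iso M_iso] in simp_all)
qed

end
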